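(* Let $B\ge 1$, let $x_{\rm tr}\in\mathbb{C}^B\setminus\{0\}$ be a fixed training vector, let $\sigma_x^2,\sigma_w^2>0$, and let the channel $h$ be a complex random variable with known prior distribution, $E[|h|^2]>0$ and $E[|h|^4]<\infty$. Then the MVU filter $f_{\rm MVU}=x_{\rm tr}/\|x_{\rm tr}\|^2$ is an optimal channel estimator for the task of minimizing $\left[\mathrm{MSE}_{xe}^{rc}(\mathrm{ZF})\right]_0$; that is, $f_{\rm MVU}$ minimizes $f\mapsto\left[\mathrm{MSE}_{xe}^{rc}(\mathrm{ZF})\right]_0(f)$ over $f\in\mathbb{C}^B\setminus\{0\}$.
   Context: Training model: $y_{\rm tr}=h\,x_{\rm tr}+w_{\rm tr}$, where $w_{\rm tr}\in\mathbb{C}^B$ is independent of $h$ and has i.i.d. circularly symmetric complex Gaussian entries of mean $0$ and variance $\sigma_w^2$. A linear channel estimator is determined by a filter $f\in\mathbb{C}^B$ through $\hat h=f^H y_{\rm tr}$. The data symbols have mean zero and power $\sigma_x^2$. The zeroth order excess MSE of the zero-forcing equalizer for a random channel is, with $\varphi=f^Hx_{\rm tr}$, $$\left[\mathrm{MSE}_{xe}^{rc}(\mathrm{ZF})\right]_0(f)=\frac{|\varphi-1|^2\left(E[|h|^4]\sigma_x^2+E[|h|^2]\sigma_w^2\right)+\sigma_w^2\|f\|^2\left(E[|h|^2]\sigma_x^2+\sigma_w^2\right)}{E[|h|^4]\,|\varphi|^2+\sigma_w^2\|f\|^2E[|h|^2]}.$$ *)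

theory Defs
  imports "HOL-Probability.Probability"
begin

text \<open>The product \<open>f\<^sup>H x\<close>: conjugate-linear in the first argument. The library's \<open>inner\<close> on
  \<open>complex ^ 'n\<close> is only its real part, and its \<open>norm\<close> is the Euclidean norm on \<open>\<complex>\<^sup>B\<close>, where
  \<open>B = CARD('n)\<close>.\<close>

definition hprod :: "complex ^ 'n \<Rightarrow> complex ^ 'n \<Rightarrow> complex" where
  "hprod f x = (\<Sum>i\<in>UNIV. cnj (f $ i) * x $ i)"

definition f_MVU :: "complex ^ 'n \<Rightarrow> complex ^ 'n" where
  "f_MVU x = (1 / (norm x)\<^sup>2) *\<^sub>R x"

text \<open>Zeroth order excess MSE of the zero-forcing equalizer for a random channel \<open>h\<close> on \<open>M\<close>,
  with symbol power \<open>\<sigma>\<^sub>x\<^sup>2\<close>, noise variance \<open>\<sigma>\<^sub>w\<^sup>2\<close>, training vector \<open>x\<close> and channel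
  estimate \<open>f\<^sup>H y\<close>, where \<open>y = h x + w\<close> is the received training signal.
  The arguments \<open>\<sigma>\<^sub>x\<close> and \<open>\<sigma>\<^sub>w\<close> are standard deviations.\<close>

definition MSE_ZF_0 ::
  "'a measure \<Rightarrow> ('a \<Rightarrow> complex) \<Rightarrow> real \<Rightarrow> real \<Rightarrow> complex ^ 'n \<Rightarrow> complex ^ 'n \<Rightarrow> real" where
  "MSE_ZF_0 M h \<sigma>\<^sub>x \<sigma>\<^sub>w x f =
    (let \<phi> = hprod f x;
         m2 = (\<integral>\<omega>. (cmod (h \<omega>)) ^ 2 \<partial>M);
         m4 = (\<integral>\<omega>. (cmod (h \<omega>)) ^ 4 \<partial>M)
     in ((cmod (\<phi> - 1))\<^sup>2 * (m4 * \<sigma>\<^sub>x\<^sup>2 + m2 * \<sigma>\<^sub>w\<^sup>2)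
          + \<sigma>\<^sub>w\<^sup>2 * (norm f)\<^sup>2 * (m2 * \<sigma>\<^sub>x\<^sup>2 + \<sigma>\<^sub>w\<^sup>2))
        / (m4 * (cmod \<phi>)\<^sup>2 + \<sigma>\<^sub>w\<^sup>2 * (norm f)\<^sup>2 * m2))"

end

theory Submission
  imports Defs
begin

text \<open>Write \<open>\<phi> = f\<^sup>H x\<close>. At the MVU filter \<open>\<phi> = 1\<close>, so its value is
  \<open>\<sigma>\<^sub>w\<^sup>2 b / (m\<^sub>4 \<parallel>x\<parallel>\<^sup>2 + \<sigma>\<^sub>w\<^sup>2 m\<^sub>2)\<close> with \<open>b = m\<^sub>2 \<sigma>\<^sub>x\<^sup>2 + \<sigma>\<^sub>w\<^sup>2\<close>. For any other filter, drop the
  nonnegative \<open>\<bar>\<phi> - 1\<bar>\<^sup>2\<close> term from the numerator and cross-multiply: what remains is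
  \<open>\<sigma>\<^sub>w\<^sup>2 b m\<^sub>4 (\<parallel>f\<parallel>\<^sup>2 \<parallel>x\<parallel>\<^sup>2 - \<bar>\<phi>\<bar>\<^sup>2) \<ge> 0\<close>, the Cauchy-Schwarz inequality.\<close>

text \<open>The triangle inequality reduces this to the real Cauchy-Schwarz inequality for the
  vectors of moduli; a bound on \<open>inner\<close> would control only the real part of
  \<open>hprod\<close>.\<close>

lemma cmod_hprod_le: "cmod (hprod f x) \<le> norm f * norm x"
proof -
  have "cmod (hprod f x) \<le> (\<Sum>i\<in>UNIV. \<bar>cmod (f $ i)\<bar> * \<bar>cmod (x $ i)\<bar>)"
    unfolding hprod_def by (rule order_trans[OF norm_sum]) (simp add: norm_mult)
  also have "\<dots> \<le> norm f * norm x"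
    unfolding norm_vec_def by (rule L2_set_mult_ineq)
  finally show ?thesis .
qed

lemma hprod_self: "hprod x x = of_real ((norm x)\<^sup>2)"
proof -
  have "(norm x)\<^sup>2 = (\<Sum>i\<in>UNIV. (cmod (x $ i))\<^sup>2)"
    unfolding norm_vec_def L2_set_def by (simp add: sum_nonneg)
  then show ?thesis
    unfolding hprod_def by (simp only: of_real_sum complex_norm_square mult.commute)
qed

lemma hprod_f_MVU:
  assumes "x \<noteq> 0"
  shows "hprod (f_MVU x) x = 1"
proof -
  \<comment> \<open>The scaling factor is real, so conjugating the first argument leaves it
    unchanged.\<close>
  have "hprod (f_MVU x) x = (1 / (norm x)\<^sup>2) *\<^sub>R hprod x x"
    unfolding hprod_def f_MVU_def by (simp add: scaleR_sum_right)
  then show ?thesis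
    using assms by (simp add: hprod_self scaleR_conv_of_real)
qed

lemma norm_f_MVU: "norm (f_MVU x) = 1 / norm x"
  \<comment> \<open>At \<open>x = 0\<close> both sides are 0, because division by zero yields
    0.\<close>
  by (cases "x = 0") (simp_all add: f_MVU_def power2_eq_square)

lemma MSE_ZF_0_f_MVU:
  fixes M :: "'a measure" and h :: "'a \<Rightarrow> complex"
  defines "m2 \<equiv> (\<integral>\<omega>. (cmod (h \<omega>)) ^ 2 \<partial>M)" and "m4 \<equiv> (\<integral>\<omega>. (cmod (h \<omega>)) ^ 4 \<partial>M)"
  assumes "x \<noteq> 0"
  shows "MSE_ZF_0 M h \<sigma>\<^sub>x \<sigma>\<^sub>w x (f_MVU x) =
    \<sigma>\<^sub>w\<^sup>2 * (m2 * \<sigma>\<^sub>x\<^sup>2 + \<sigma>\<^sub>w\<^sup>2) / (m4 * (norm x)\<^sup>2 + \<sigma>\<^sub>w\<^sup>2 * m2)"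
proof -
  define X where "X = (norm x)\<^sup>2"
  have X: "X \<noteq> 0"
    using assms by (simp add: X_def)
  have "MSE_ZF_0 M h \<sigma>\<^sub>x \<sigma>\<^sub>w x (f_MVU x) =
      (\<sigma>\<^sub>w\<^sup>2 * (1 / X) * (m2 * \<sigma>\<^sub>x\<^sup>2 + \<sigma>\<^sub>w\<^sup>2)) / (m4 + \<sigma>\<^sub>w\<^sup>2 * (1 / X) * m2)"
    using assms
    by (simp add: MSE_ZF_0_def Let_def hprod_f_MVU norm_f_MVU power_divide X_def)
  \<comment> \<open>Expanding the fraction by \<open>X\<close> clears the inner
    \<open>1 / X\<close>.\<close>
  also have "\<dots> = (X * (\<sigma>\<^sub>w\<^sup>2 * (1 / X) * (m2 * \<sigma>\<^sub>x\<^sup>2 + \<sigma>\<^sub>w\<^sup>2)))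
      / (X * (m4 + \<sigma>\<^sub>w\<^sup>2 * (1 / X) * m2))"
    using X by (subst mult_divide_mult_cancel_left) simp_all
  also have "\<dots> = \<sigma>\<^sub>w\<^sup>2 * (m2 * \<sigma>\<^sub>x\<^sup>2 + \<sigma>\<^sub>w\<^sup>2) / (m4 * X + \<sigma>\<^sub>w\<^sup>2 * m2)"
    using X by (simp add: distrib_left mult.commute)
  finally show ?thesis
    by (simp add: X_def)
qed

text \<open>The lower bound is the value attained at \<open>f_MVU x\<close>.\<close>

lemma MSE_ZF_0_ge:
  fixes M :: "'a measure" and h :: "'a \<Rightarrow> complex"
  defines "m2 \<equiv> (\<integral>\<omega>. (cmod (h \<omega>)) ^ 2 \<partial>M)" and "m4 \<equiv> (\<integral>\<omega>. (cmod (h \<omega>)) ^ 4 \<partial>M)"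
  assumes m2: "m2 > 0" and sw: "\<sigma>\<^sub>w\<^sup>2 > 0" and "f \<noteq> 0"
  shows "\<sigma>\<^sub>w\<^sup>2 * (m2 * \<sigma>\<^sub>x\<^sup>2 + \<sigma>\<^sub>w\<^sup>2) / (m4 * (norm x)\<^sup>2 + \<sigma>\<^sub>w\<^sup>2 * m2) \<le> MSE_ZF_0 M h \<sigma>\<^sub>x \<sigma>\<^sub>w x f"
proof -
  define q where "q = (cmod (hprod f x))\<^sup>2"
  define n where "n = (norm f)\<^sup>2"
  define X where "X = (norm x)\<^sup>2"
  define d where "d = (cmod (hprod f x - 1))\<^sup>2 * (m4 * \<sigma>\<^sub>x\<^sup>2 + m2 * \<sigma>\<^sub>w\<^sup>2)"
  define b where "b = m2 * \<sigma>\<^sub>x\<^sup>2 + \<sigma>\<^sub>w\<^sup>2"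
  have m4: "m4 \<ge> 0"
    unfolding m4_def by simp
  have n: "n > 0"
    using \<open>f \<noteq> 0\<close> by (simp add: n_def)
  have b: "b \<ge> 0" and d: "d \<ge> 0"
    using m2 m4 by (simp_all add: b_def d_def)
  have q: "q \<le> n * X"
    unfolding q_def n_def X_def using cmod_hprod_le[of f x]
    by (metis norm_ge_zero power_mono power_mult_distrib)
  \<comment> \<open>The noise terms keep both denominators positive even when \<open>m4\<close> or
    \<open>q\<close> vanishes; \<open>f \<noteq> 0\<close> enters here through
    \<open>n\<close>.\<close>
  have D: "m4 * X + \<sigma>\<^sub>w\<^sup>2 * m2 > 0" "m4 * q + \<sigma>\<^sub>w\<^sup>2 * n * m2 > 0"
    using m2 m4 n sw by (simp_all add: X_def q_def add_nonneg_pos)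
  \<comment> \<open>Replacing \<open>q\<close> by \<open>n * X\<close> makes the denominator for
    \<open>f\<close> equal to \<open>n\<close> times the one for the MVU filter.\<close>
  have "\<sigma>\<^sub>w\<^sup>2 * b * (m4 * q + \<sigma>\<^sub>w\<^sup>2 * n * m2) \<le> \<sigma>\<^sub>w\<^sup>2 * b * (m4 * (n * X) + \<sigma>\<^sub>w\<^sup>2 * n * m2)"
    using m4 b q by (intro mult_left_mono add_right_mono) simp_all
  also have "\<dots> = \<sigma>\<^sub>w\<^sup>2 * n * b * (m4 * X + \<sigma>\<^sub>w\<^sup>2 * m2)"
    by (simp add: algebra_simps)
  also have "\<dots> \<le> (d + \<sigma>\<^sub>w\<^sup>2 * n * b) * (m4 * X + \<sigma>\<^sub>w\<^sup>2 * m2)"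
    using d D(1) by (intro mult_right_mono) simp_all
  finally have "\<sigma>\<^sub>w\<^sup>2 * b / (m4 * X + \<sigma>\<^sub>w\<^sup>2 * m2) \<le> (d + \<sigma>\<^sub>w\<^sup>2 * n * b) / (m4 * q + \<sigma>\<^sub>w\<^sup>2 * n * m2)"
    using D by (simp add: frac_le_eq divide_le_0_iff)
  then show ?thesis
    unfolding MSE_ZF_0_def Let_def b_def d_def n_def q_def X_def m2_def m4_def .
qed

theorem proposition4:
  fixes M :: "'a measure"
    and h :: "'a \<Rightarrow> complex"
    and x_tr :: "complex ^ 'n"
    and \<sigma>\<^sub>x \<sigma>\<^sub>w :: real
  assumes "prob_space M"
    and "h \<in> borel_measurable M"
    and "integrable M (\<lambda>\<omega>. (cmod (h \<omega>)) ^ 4)"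
    and "(\<integral>\<omega>. (cmod (h \<omega>)) ^ 2 \<partial>M) > 0"
    and "x_tr \<noteq> 0"
    and "\<sigma>\<^sub>x\<^sup>2 > 0"
    and "\<sigma>\<^sub>w\<^sup>2 > 0"
  shows "is_arg_min (MSE_ZF_0 M h \<sigma>\<^sub>x \<sigma>\<^sub>w x_tr) (\<lambda>f. f \<noteq> 0) (f_MVU x_tr)"
proof -
  have "f_MVU x_tr \<noteq> 0"
    using assms(5) by (simp add: f_MVU_def)
  then show ?thesis
    using assms(4,5,7) by (simp add: is_arg_min_linorder MSE_ZF_0_f_MVU MSE_ZF_0_ge)
qed

end
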